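(* For any integers $c,d\ge 2$ we have \[ \phi\left(n,\,c(d+1),\,\binom{c(d+1)}{2} - dc + (d+1) \right) = \Omega\left(n^{1+\frac{1}{d}}\right), \] where the constant implicit in the $\Omega$-notation depends only on $c$ and $d$.
   Context: For a finite point set $\mathcal P\subset\mathbb R^2$, the number of distinct distances it determines is $|\{|pq| : p,q\in\mathcal P,\ p\neq q\}|$, where $|pq|$ is the Euclidean distance. For positive integers $n,k,l$, $\phi(n,k,l)$ denotes the minimum number of distinct distances determined by a set $\mathcal P$ of $n$ points in $\mathbb R^2$ with the property that every $k$ points of $\mathcal P$ determine at least $l$ distinct distances. *)

theory Defs
  imports "HOL-Analysis.Analysis" "HOL-Library.Landau_Symbols"
begin

definition distances :: "(real^2) set \<Rightarrow> real set" where
  "distances P = {dist p q | p q. p \<in> P \<and> q \<in> P \<and> p \<noteq> q}"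

definition num_distances :: "(real^2) set \<Rightarrow> nat" where
  "num_distances P = card (distances P)"

definition local_property :: "nat \<Rightarrow> nat \<Rightarrow> (real^2) set \<Rightarrow> bool" where
  "local_property k l P \<longleftrightarrow> (\<forall>Q. Q \<subseteq> P \<and> card Q = k \<longrightarrow> num_distances Q \<ge> l)"

(* On nat the infimum of a nonempty set is its minimum, while Inf {} is an unspecified constant.
   Admissible sets exist for every n whenever l \<le> k choose 2, since the points (2^i, 0)
   with i < n have pairwise distinct distances. *)
definition phi :: "nat \<Rightarrow> nat \<Rightarrow> nat \<Rightarrow> nat" where
  "phi n k l = Inf {num_distances P | P. finite P \<and> card P = n \<and> local_property k l P}"

end

theory Submission imports Defs begin

text \<open>Colour each pair of points by its distance and put \<open>m = d + 1\<close>, \<open>k = c m\<close>. Consider \<open>m\<close>-tuples of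
  pairwise disjoint edges of a common colour. If there are \<open>o(n powr (1 + 1/d))\<close> colours, then by the
  power mean inequality the pairs of a colour and an \<open>m\<close>-tuple of start points of such edges outnumber
  the \<open>n ^ m\<close> tuples of points by any constant factor. Hence some tuple of points occurs in many
  colours, and \<open>c - 1\<close> of these can be chosen so that all end points are distinct. The resulting \<open>c m\<close>
  points contain \<open>(c - 1) m\<close> edges with only \<open>c - 1\<close> colours, which the local property forbids.
  The local property also bounds every monochromatic degree by \<open>k\<close>, since a monochromatic star on
  \<open>k\<close> points has too few distances; this is what makes almost all tuples of edges disjoint.\<close>

section \<open>Distances as colours of unordered edges, and the cost of repeated colours\<close>

lemma diameter_pair: "diameter {p, q} = dist p q"
proof -
  have "(\<lambda>(x, y). dist x y) ` ({p, q} \<times> {p, q}) = {0, dist p q}"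
    by (auto simp: dist_commute)
  then show ?thesis
    by (simp add: diameter_def cSup_eq_Max)
qed

text \<open>Taking \<open>diameter\<close> as the colour of a two-element set turns the distances
  into an image over unordered edges, so repeated distances become a failure of injectivity.\<close>

lemma distances_eq_diameter_image: "distances Q = diameter ` {e. e \<subseteq> Q \<and> card e = 2}"
proof (intro equalityI subsetI)
  fix x assume "x \<in> distances Q"
  then obtain p q where "p \<in> Q" "q \<in> Q" "p \<noteq> q" "x = diameter {p, q}"
    by (auto simp: distances_def diameter_pair)
  then show "x \<in> diameter ` {e. e \<subseteq> Q \<and> card e = 2}"
    by (intro image_eqI[of _ _ "{p, q}"]) auto
next
  fix x assume "x \<in> diameter ` {e. e \<subseteq> Q \<and> card e = 2}"
  then show "x \<in> distances Q"
    by (fastforce simp: distances_def card_2_iff diameter_pair)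
qed

lemma finite_distances: "finite Q \<Longrightarrow> finite (distances Q)"
  unfolding distances_eq_diameter_image by auto

text \<open>The edges in \<open>F\<close> contribute at most \<open>card C\<close> distances, every
  other edge at most one. The additive form avoids subtraction on \<open>nat\<close>.\<close>

lemma num_distances_add_card_le:
  assumes "finite Q" "finite C" "F \<subseteq> {e. e \<subseteq> Q \<and> card e = 2}" "diameter ` F \<subseteq> C"
  shows "num_distances Q + card F \<le> (card Q choose 2) + card C"
proof -
  let ?A = "{e. e \<subseteq> Q \<and> card e = 2}"
  have fin: "finite ?A" using assms(1) by simp
  have "distances Q \<subseteq> C \<union> diameter ` (?A - F)"
    unfolding distances_eq_diameter_image using assms(4) by blast
  then have "num_distances Q \<le> card (C \<union> diameter ` (?A - F))"
    unfolding num_distances_def using assms(2) fin by (intro card_mono) auto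
  also have "\<dots> \<le> card C + card (?A - F)"
    using card_Un_le[of C "diameter ` (?A - F)"] card_image_le[of "?A - F" diameter] fin
    by simp
  finally have "num_distances Q \<le> card C + card (?A - F)" .
  moreover have "card (?A - F) + card F = card Q choose 2"
    using card_Diff_subset[OF _ assms(3)] card_mono[OF fin assms(3)] n_subsets[OF assms(1)]
      finite_subset[OF assms(3) fin] by simp
  ultimately show ?thesis by simp
qed

text \<open>A star of \<open>k - 1\<close> edges of one length spans \<open>k\<close> points and
  merges \<open>k - 1\<close> potential distances into one, which leaves at most
  \<open>(k choose 2) - (k - 1) + 1 < l\<close>.\<close>

lemma card_equidistant_less:
  assumes "finite P" "local_property k l P" "(k choose 2) + 2 < l + k" "0 < \<delta>" "v \<in> P" "2 \<le> k"
  shows "card {u \<in> P. dist v u = \<delta>} < k - 1"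
proof (rule ccontr)
  assume "\<not> ?thesis"
  then obtain U where U: "U \<subseteq> {u \<in> P. dist v u = \<delta>}" "card U = k - 1" "finite U"
    by (meson not_less obtain_subset_with_card_n)
  have v: "v \<notin> U" using U assms(4) by auto
  have k: "card (insert v U) = k" using U v assms(6) by simp
  have "inj_on (\<lambda>u. {v, u}) U" by (auto simp: inj_on_def doubleton_eq_iff)
  then have F: "card ((\<lambda>u. {v, u}) ` U) = k - 1" using U by (simp add: card_image)
  have "num_distances (insert v U) + card ((\<lambda>u. {v, u}) ` U) \<le> (card (insert v U) choose 2) + card {\<delta>}"
  proof (rule num_distances_add_card_le)
    show "(\<lambda>u. {v, u}) ` U \<subseteq> {e. e \<subseteq> insert v U \<and> card e = 2}"
      using v by (auto simp: card_2_iff)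
    show "diameter ` (\<lambda>u. {v, u}) ` U \<subseteq> {\<delta>}"
      using U by (auto simp: diameter_pair)
  qed (use U in auto)
  moreover have "l \<le> num_distances (insert v U)"
    using assms(2,5) U k unfolding local_property_def by blast
  ultimately show False using assms(3,6) F k by simp
qed

section \<open>Tuples of disjoint edges, and colours with distinct end points\<close>

text \<open>Given \<open>xs\<close>, a new element \<open>x\<close> must avoid \<open>xs\<close>, \<open>g ` xs\<close> and the fibres of \<open>g\<close> over both.\<close>
lemma card_distinct_append_map_ge:
  fixes g :: "'a \<Rightarrow> 'a"
  assumes "finite V" "\<And>x. x \<in> V \<Longrightarrow> g x \<noteq> x" "\<And>y. card {x \<in> V. g x = y} < k" "i \<le> j"
  shows "(card V - 2 * k * j) ^ i
    \<le> card {xs. length xs = i \<and> set xs \<subseteq> V \<and> distinct (xs @ map g xs)}"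
  using assms(4)
proof (induction i)
  case 0
  have "{xs. length xs = 0 \<and> set xs \<subseteq> V \<and> distinct (xs @ map g xs)} = {[]}" by auto
  then show ?case by simp
next
  case (Suc i)
  define S where "S i = {xs. length xs = i \<and> set xs \<subseteq> V \<and> distinct (xs @ map g xs)}" for i
  define T where "T xs = set (xs @ map g xs)" for xs
  define B where "B xs = T xs \<union> (\<Union>y\<in>T xs. {x \<in> V. g x = y})" for xs
  have finS: "finite (S i)" for i
    by (rule finite_subset[OF _ finite_lists_length_eq[OF assms(1), of i]]) (auto simp: S_def)
  have finB: "finite (B xs)" for xs using assms(1) by (auto simp: B_def T_def)
  have B: "card (B xs) \<le> 2 * k * j" if "xs \<in> S i" for xs
  proof -
    have T: "card (T xs) \<le> 2 * i"
      using card_length[of "xs @ map g xs"] that unfolding T_def S_def by auto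
    have "card (B xs) \<le> card (T xs) + (\<Sum>y\<in>T xs. card {x \<in> V. g x = y})"
      unfolding B_def
      by (rule order_trans[OF card_Un_le add_left_mono[OF card_UN_le]]) (simp add: T_def)
    \<comment> \<open>The strict fibre bound leaves room for \<open>y\<close> itself, so each point
      already used excludes at most \<open>k\<close> elements.\<close>
    also have "\<dots> = (\<Sum>y\<in>T xs. Suc (card {x \<in> V. g x = y}))"
      by (simp add: sum_Suc)
    also have "\<dots> \<le> (\<Sum>y\<in>T xs. k)"
      using assms(3) by (intro sum_mono) (simp add: Suc_leI)
    also have "\<dots> \<le> 2 * i * k" using T by simp
    also have "\<dots> \<le> 2 * k * j" using Suc.prems by simp
    finally show ?thesis .
  qed
  have "(card V - 2 * k * j) ^ Suc i \<le> (\<Sum>xs\<in>S i. card V - 2 * k * j)"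
    using Suc unfolding S_def[symmetric] by (simp add: mult.commute)
  also have "\<dots> \<le> (\<Sum>xs\<in>S i. card (V - B xs))"
  proof (intro sum_mono)
    fix xs assume "xs \<in> S i"
    then show "card V - 2 * k * j \<le> card (V - B xs)"
      using B[of xs] diff_card_le_card_Diff[OF finB[of xs], of V] by linarith
  qed
  also have "\<dots> = card (Sigma (S i) (\<lambda>xs. V - B xs))"
    using finS assms(1) by simp
  also have "\<dots> = card ((\<lambda>(xs, x). x # xs) ` Sigma (S i) (\<lambda>xs. V - B xs))"
    by (intro card_image[symmetric]) (auto simp: inj_on_def)
  also have "\<dots> \<le> card (S (Suc i))"
  proof (intro card_mono finS image_subsetI)
    fix z assume "z \<in> Sigma (S i) (\<lambda>xs. V - B xs)"
    then obtain xs x where z: "z = (xs, x)" "xs \<in> S i" "x \<in> V" "x \<notin> T xs" "g x \<notin> T xs"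
      by (auto simp: B_def)
    then show "(\<lambda>(xs, x). x # xs) z \<in> S (Suc i)"
      using assms(2)[of x] unfolding S_def T_def by (auto simp: image_iff)
  qed
  finally show ?case by (simp add: S_def)
qed

text \<open>Each \<open>x\<close> and each point already chosen exclude only the one colour \<open>\<delta>\<close> that is their distance.\<close>
lemma exists_colours_inj_on:
  fixes g :: "real \<Rightarrow> 'a::metric_space \<Rightarrow> 'a"
  assumes "finite X" "finite \<Delta>" "j * card X ^ 2 < card \<Delta>" "X \<noteq> {}"
    and "\<And>\<delta>. \<delta> \<in> \<Delta> \<Longrightarrow> inj_on (g \<delta>) X"
    and "\<And>\<delta> x. \<delta> \<in> \<Delta> \<Longrightarrow> x \<in> X \<Longrightarrow> dist x (g \<delta> x) = \<delta>"
  shows "\<exists>\<Delta>'\<subseteq>\<Delta>. card \<Delta>' = j \<and> inj_on (\<lambda>(\<delta>, x). g \<delta> x) (\<Delta>' \<times> X)"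
  using assms(3)
proof (induction j)
  case 0
  then show ?case by (intro exI[of _ "{}"]) auto
next
  case (Suc j)
  then obtain D where D: "D \<subseteq> \<Delta>" "card D = j" "inj_on (\<lambda>(\<delta>, x). g \<delta> x) (D \<times> X)"
    by auto
  define U where "U = (\<lambda>(\<delta>, x). g \<delta> x) ` (D \<times> X)"
  define B where "B = (\<lambda>(x, u). dist x u) ` (X \<times> U)"
  have finD: "finite D" using D assms(2) finite_subset by blast
  have finU: "finite U" unfolding U_def using finD assms(1) by simp
  have "card U \<le> j * card X"
    unfolding U_def using card_image_le[of "D \<times> X" "\<lambda>(\<delta>, x). g \<delta> x"] finD assms(1) D
    by (simp add: card_cartesian_product)
  then have "card X * card U \<le> card X * (j * card X)" by simp
  moreover have "card B \<le> card X * card U"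
    unfolding B_def using card_image_le[of "X \<times> U" "\<lambda>(x, u). dist x u"] finU assms(1)
    by (simp add: card_cartesian_product)
  ultimately have "card B \<le> card X * (j * card X)" by linarith
  then have cB: "card B \<le> j * card X ^ 2"
    by (simp only: power2_eq_square mult_ac)
  \<comment> \<open>The colours chosen so far are already among the distances in \<open>B\<close>,
    so a colour outside \<open>B\<close> is automatically new and \<open>B\<close> is all that must
    be avoided.\<close>
  have "D \<subseteq> B"
  proof
    fix \<delta> assume \<delta>: "\<delta> \<in> D"
    obtain x where x: "x \<in> X" using assms(4) by blast
    then have "dist x (g \<delta> x) = \<delta>" using \<delta> D assms(6) by blast
    then show "\<delta> \<in> B" using \<delta> x unfolding B_def U_def by force
  qed
  have "card B < card \<Delta>" using cB Suc.prems by simp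
  then obtain \<delta> where \<delta>: "\<delta> \<in> \<Delta>" "\<delta> \<notin> B"
    using card_mono[of B \<Delta>] finU assms(1) unfolding B_def by fastforce
  have new: "g \<delta> x \<notin> U" if "x \<in> X" for x
    using \<delta> assms(6)[OF \<delta>(1) that] that unfolding B_def by force
  have "inj_on (\<lambda>(\<delta>, x). g \<delta> x) (insert \<delta> D \<times> X)"
    unfolding inj_on_def
  proof (clarify, goal_cases)
    case (1 a x b y)
    have U: "g e z \<in> U" if "e \<in> D" "z \<in> X" for e z using that by (auto simp: U_def)
    consider "a = \<delta>" "b = \<delta>" | "a = \<delta>" "b \<in> D" | "a \<in> D" "b = \<delta>" | "a \<in> D" "b \<in> D"
      using 1 by auto
    then show ?case
    proof cases
      case 1
      then show ?thesis using assms(5)[OF \<delta>(1)] \<open>g a x = g b y\<close> \<open>x \<in> X\<close> \<open>y \<in> X\<close>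
        by (auto simp: inj_on_def)
    next
      case 2
      then show ?thesis using new[of x] U[of b y] \<open>g a x = g b y\<close> \<open>x \<in> X\<close> \<open>y \<in> X\<close> by simp
    next
      case 3
      then show ?thesis using new[of y] U[of a x] \<open>g a x = g b y\<close> \<open>x \<in> X\<close> \<open>y \<in> X\<close> by simp
    next
      case 4
      then show ?thesis using inj_onD[OF D(3), of "(a, x)" "(b, y)"] \<open>g a x = g b y\<close> \<open>x \<in> X\<close> \<open>y \<in> X\<close>
        by simp
    qed
  qed
  moreover have "card (insert \<delta> D) = Suc j"
    using D \<delta> \<open>D \<subseteq> B\<close> finD by (subst card_insert_disjoint) auto
  ultimately show ?case using D \<delta> by (intro exI[of _ "insert \<delta> D"]) auto
qed

text \<open>The bound is the threshold of \<open>exists_colours_inj_on\<close> for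
  \<open>card X = m\<close>. Beyond it, \<open>j\<close> colours give \<open>j * m\<close> distinct
  end points, and together with \<open>X\<close> a set of \<open>(j + 1) * m\<close> points on which
  \<open>j * m\<close> edges share \<open>j\<close> colours.\<close>

lemma few_colours_at_tuple:
  assumes "finite P" "local_property ((j + 1) * m) l P" "0 < m"
    and "(((j + 1) * m) choose 2) + j < l + j * m"
    and "finite \<Delta>" "finite X" "card X = m" "X \<subseteq> P"
    and "\<And>\<delta>. \<delta> \<in> \<Delta> \<Longrightarrow> inj_on (g \<delta>) X"
    and "\<And>\<delta>. \<delta> \<in> \<Delta> \<Longrightarrow> g \<delta> ` X \<subseteq> P - X"
    and "\<And>\<delta> x. \<delta> \<in> \<Delta> \<Longrightarrow> x \<in> X \<Longrightarrow> dist x (g \<delta> x) = \<delta>"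
  shows "card \<Delta> \<le> j * m ^ 2"
proof (rule ccontr)
  assume "\<not> ?thesis"
  then obtain D where D: "D \<subseteq> \<Delta>" "card D = j" "inj_on (\<lambda>(\<delta>, x). g \<delta> x) (D \<times> X)"
    using exists_colours_inj_on[OF assms(6,5), of j g] assms(3,7,9,11) by fastforce
  define Y where "Y = (\<lambda>(\<delta>, x). g \<delta> x) ` (D \<times> X)"
  have finD: "finite D" using D assms(5) finite_subset by blast
  have Y: "card Y = j * m" "finite Y"
    unfolding Y_def using finD assms(6,7) D by (simp_all add: card_image card_cartesian_product)
  have XY: "X \<inter> Y = {}" using assms(10) D(1) unfolding Y_def by fastforce
  have gY: "g \<delta> x \<in> Y" if "\<delta> \<in> D" "x \<in> X" for \<delta> x using that by (auto simp: Y_def)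
  have Q: "card (X \<union> Y) = (j + 1) * m" using XY Y assms(6,7) by (simp add: card_Un_disjoint)
  define F where "F = (\<lambda>(\<delta>, x). {x, g \<delta> x}) ` (D \<times> X)"
  \<comment> \<open>Since \<open>X\<close> and \<open>Y\<close> are disjoint, an edge has exactly
    one end in \<open>X\<close>. This identifies \<open>x\<close>, and the other end then identifies
    the colour.\<close>
  have "inj_on (\<lambda>(\<delta>, x). {x, g \<delta> x}) (D \<times> X)"
    unfolding inj_on_def
  proof (clarify, goal_cases)
    case (1 a x b y)
    then have "x = y" "g a x = g b y" using XY gY by (auto simp: doubleton_eq_iff)
    then show ?case using inj_onD[OF D(3), of "(a, x)" "(b, y)"] 1 by simp
  qed
  then have F: "card F = j * m"
    unfolding F_def using D assms(7) by (simp add: card_image card_cartesian_product)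
  have "num_distances (X \<union> Y) + card F \<le> (card (X \<union> Y) choose 2) + card D"
  proof (rule num_distances_add_card_le)
    show "F \<subseteq> {e. e \<subseteq> X \<union> Y \<and> card e = 2}"
      unfolding F_def using gY XY by (fastforce simp: card_2_iff)
    show "diameter ` F \<subseteq> D"
      unfolding F_def using assms(11) D by (auto simp: diameter_pair)
  qed (use assms(6) Y finD in auto)
  moreover have "X \<union> Y \<subseteq> P" using assms(8,10) D(1) unfolding Y_def by fastforce
  then have "l \<le> num_distances (X \<union> Y)"
    using assms(2) Q unfolding local_property_def by blast
  ultimately show False using assms(4) F Q D by simp
qed

section \<open>Double counting of colours against tuples of points\<close>

definition points_at_distance :: "'a::metric_space set \<Rightarrow> real \<Rightarrow> 'a set" where
  "points_at_distance P \<delta> = {p \<in> P. \<exists>q\<in>P. dist p q = \<delta>}"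

text \<open>Ordered pairs of distinct points are grouped by distance and first point. Each group
  lies on a circle about its first point, so the degree bound limits its size to
  \<open>k\<close>.\<close>

lemma sum_points_at_distance_ge:
  assumes "finite P" "local_property k l P" "(k choose 2) + 2 < l + k" "2 \<le> k"
  shows "card P * (card P - 1) \<le> k * (\<Sum>\<delta>\<in>distances P. card (points_at_distance P \<delta>))"
proof -
  have "card P * (card P - 1) = card (Sigma P (\<lambda>p. P - {p}))"
    using assms(1) by simp
  also have "\<dots> \<le> card (SIGMA \<delta>:distances P. SIGMA p:points_at_distance P \<delta>. {q \<in> P. dist p q = \<delta>})"
    (is "_ \<le> card ?S")
  proof (rule card_inj_on_le)
    show "inj_on (\<lambda>(p, q). (dist p q, p, q)) (Sigma P (\<lambda>p. P - {p}))"
      by (auto simp: inj_on_def)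
    show "(\<lambda>(p, q). (dist p q, p, q)) ` (Sigma P (\<lambda>p. P - {p})) \<subseteq> ?S"
      by (auto simp: points_at_distance_def distances_def)
    show "finite ?S"
      using assms(1) finite_distances by (intro finite_SigmaI) (auto simp: points_at_distance_def)
  qed
  also have "\<dots> = (\<Sum>\<delta>\<in>distances P. \<Sum>p\<in>points_at_distance P \<delta>. card {q \<in> P. dist p q = \<delta>})"
    using assms(1) finite_distances[OF assms(1)]
    by (simp add: card_SigmaI points_at_distance_def)
  also have "\<dots> \<le> (\<Sum>\<delta>\<in>distances P. \<Sum>p\<in>points_at_distance P \<delta>. k)"
  proof (intro sum_mono)
    fix \<delta> p assume "\<delta> \<in> distances P" "p \<in> points_at_distance P \<delta>"
    then have "0 < \<delta>" "p \<in> P" by (auto simp: distances_def points_at_distance_def)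
    then show "card {q \<in> P. dist p q = \<delta>} \<le> k"
      using card_equidistant_less[OF assms(1-3), of \<delta> p] assms(4) by simp
  qed
  finally show ?thesis by (simp add: sum_distrib_left mult.commute)
qed

text \<open>Pairs of a colour and a list of \<open>m\<close> start points are counted twice:
  \<open>card_distinct_append_map_ge\<close> bounds the lists per colour from below,
  \<open>few_colours_at_tuple\<close> the colours per list from above.\<close>

lemma sum_power_points_at_distance_le:
  assumes "finite P" "local_property ((j + 1) * m) l P" "2 \<le> (j + 1) * m"
    and "(((j + 1) * m) choose 2) + 2 < l + (j + 1) * m"
    and "(((j + 1) * m) choose 2) + j < l + j * m"
  shows "(\<Sum>\<delta>\<in>distances P. (card (points_at_distance P \<delta>) - 2 * ((j + 1) * m) * m) ^ m)
    \<le> j * m ^ 2 * card P ^ m"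
proof -
  define k where "k = (j + 1) * m"
  define V where "V = points_at_distance P"
  \<comment> \<open>Fixing one partner per point and colour lets a tuple of edges be encoded by its
    start points alone, so there are only \<open>card P ^ m\<close> candidates.\<close>
  have "\<exists>g. \<forall>\<delta> p. p \<in> V \<delta> \<longrightarrow> g \<delta> p \<in> P \<and> dist p (g \<delta> p) = \<delta>"
    unfolding V_def points_at_distance_def by (intro choice allI) blast
  then obtain g where g: "\<And>\<delta> p. p \<in> V \<delta> \<Longrightarrow> g \<delta> p \<in> P" "\<And>\<delta> p. p \<in> V \<delta> \<Longrightarrow> dist p (g \<delta> p) = \<delta>"
    by blast
  define S where "S \<delta> = {xs. length xs = m \<and> set xs \<subseteq> V \<delta> \<and> distinct (xs @ map (g \<delta>) xs)}" for \<delta>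
  define L where "L = {xs. set xs \<subseteq> P \<and> length xs = m}"
  have VP: "V \<delta> \<subseteq> P" for \<delta> by (auto simp: V_def points_at_distance_def)
  have finL: "finite L" unfolding L_def using assms(1) by (rule finite_lists_length_eq)
  have finD: "finite (distances P)" using assms(1) by (rule finite_distances)
  have SL: "S \<delta> \<subseteq> L" for \<delta> using VP by (auto simp: S_def L_def)
  have "(\<Sum>\<delta>\<in>distances P. (card (V \<delta>) - 2 * k * m) ^ m) \<le> (\<Sum>\<delta>\<in>distances P. card (S \<delta>))"
  proof (rule sum_mono)
    fix \<delta> assume "\<delta> \<in> distances P"
    then have pos: "0 < \<delta>" by (auto simp: distances_def)
    show "(card (V \<delta>) - 2 * k * m) ^ m \<le> card (S \<delta>)"
      unfolding S_def
    proof (rule card_distinct_append_map_ge)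
      show "finite (V \<delta>)" using VP assms(1) by (rule finite_subset)
      show "g \<delta> x \<noteq> x" if "x \<in> V \<delta>" for x using g(2)[OF that] pos by auto
      \<comment> \<open>The fibre over \<open>y\<close> lies on the circle of radius \<delta> about
        \<open>y\<close>, so the degree bound applies again.\<close>
      show "card {x \<in> V \<delta>. g \<delta> x = y} < k" for y
      proof (cases "y \<in> P")
        case True
        have "card {x \<in> V \<delta>. g \<delta> x = y} \<le> card {u \<in> P. dist y u = \<delta>}"
          using assms(1) VP g by (intro card_mono) (auto simp: dist_commute)
        then show ?thesis
          using card_equidistant_less[OF assms(1,2,4) pos True assms(3)] by (simp add: k_def)
      next
        case False
        then have "{x \<in> V \<delta>. g \<delta> x = y} = {}" using g(1) by blast
        then have "card {x \<in> V \<delta>. g \<delta> x = y} = 0" by (simp only: card.empty)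
        then show ?thesis using assms(3) unfolding k_def by linarith
      qed
    qed simp
  qed
  also have "\<dots> = (\<Sum>\<delta>\<in>distances P. \<Sum>xs\<in>L. if xs \<in> S \<delta> then 1 else 0)"
    using SL finL by (intro sum.cong refl) (simp add: Int_absorb1 flip: sum.inter_restrict)
  also have "\<dots> = (\<Sum>xs\<in>L. card {\<delta> \<in> distances P. xs \<in> S \<delta>})"
    using finD by (subst sum.swap) (simp add: sum.If_cases Int_def)
  also have "\<dots> \<le> (\<Sum>xs\<in>L. j * m ^ 2)"
  proof (rule sum_mono)
    fix xs assume xs: "xs \<in> L"
    show "card {\<delta> \<in> distances P. xs \<in> S \<delta>} \<le> j * m ^ 2"
    \<comment> \<open>A list with repeated entries belongs to no \<open>S \<delta>\<close>. A
      nonempty colour set therefore guarantees \<open>card (set xs) = m\<close>.\<close>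
    proof (cases "{\<delta> \<in> distances P. xs \<in> S \<delta>} = {}")
      case False
      then have d: "distinct xs" by (auto simp: S_def)
      have m: "0 < m" using assms(3) by (cases m) auto
      show ?thesis
      proof (rule few_colours_at_tuple[OF assms(1,2) m assms(5), of _ "set xs" g])
        show "finite {\<delta> \<in> distances P. xs \<in> S \<delta>}" using finD by simp
        show "card (set xs) = m" "set xs \<subseteq> P" using xs d by (auto simp: L_def distinct_card)
      next
        fix \<delta> assume "\<delta> \<in> {\<delta> \<in> distances P. xs \<in> S \<delta>}"
        then have S: "set xs \<subseteq> V \<delta>" "distinct (xs @ map (g \<delta>) xs)" by (auto simp: S_def)
        then show "inj_on (g \<delta>) (set xs)" by (simp add: distinct_map)
        show "g \<delta> ` set xs \<subseteq> P - set xs" using S g(1) by auto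
        show "dist x (g \<delta> x) = \<delta>" if "x \<in> set xs" for x using S g(2) that by blast
      qed simp
    qed (simp only: card.empty)
  qed
  also have "\<dots> = j * m ^ 2 * card P ^ m"
    by (simp add: L_def card_lists_length_eq[OF assms(1)])
  finally show ?thesis by (simp add: k_def V_def)
qed

section \<open>The power mean inequality and the bound for a single point set\<close>

lemma sum_power_le_card_power:
  fixes f :: "'a \<Rightarrow> real"
  assumes "\<And>i. i \<in> I \<Longrightarrow> 0 \<le> f i"
  shows "(\<Sum>i\<in>I. f i) ^ Suc d \<le> real (card I) ^ d * (\<Sum>i\<in>I. f i ^ Suc d)"
proof (cases "finite I \<and> I \<noteq> {}")
  case True
  then have I: "0 < real (card I)" by (simp add: card_gt_0_iff)
  have conv: "convex_on {0::real..} (\<lambda>x. x ^ Suc d)"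
  \<comment> \<open>Even powers are convex on the whole line, odd ones in general only on the
    nonnegative reals.\<close>
  proof (cases "odd (Suc d)")
    case False
    then show ?thesis by (intro convex_on_subset[OF convex_power_even]) auto
  qed (rule convex_power_odd)
  \<comment> \<open>Jensen's inequality with equal weights \<open>1 / card I\<close>.\<close>
  have "((\<Sum>i\<in>I. f i) / card I) ^ Suc d \<le> (\<Sum>i\<in>I. f i ^ Suc d) / card I"
    using convex_on_sum[OF _ _ conv, where a = "\<lambda>x. 1 / of_nat (card I)" and S = I and y = f] True assms
    by (simp add: sum_divide_distrib)
  then show ?thesis
    using I by (simp add: power_divide divide_simps mult.commute mult.left_commute)
qed auto

text \<open>The minimum has one entry per case. In the first, the excluded points make up half of
  the total count and the number of distances is even quadratic in \<open>card P\<close>; in the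
  second, the power mean inequality yields the exponent \<open>1 + 1 / d\<close>.\<close>

lemma num_distances_ge:
  fixes P :: "(real^2) set" and j d l :: nat
  defines "k \<equiv> (j + 1) * Suc d"
  assumes "finite P" "2 \<le> card P" "local_property k l P" "1 \<le> j" "1 \<le> d"
    and "(k choose 2) + 2 < l + k" "(k choose 2) + j < l + j * Suc d"
  shows "min (1 / (8 * real k ^ 2 * real (Suc d)))
      ((1 / ((4 * real k) ^ Suc d * real (j * (Suc d) ^ 2))) powr (1 / real d))
      * real (card P) powr (1 + 1 / real d) \<le> real (num_distances P)"
proof -
  define m where "m = Suc d"
  define n where "n = real (card P)"
  define t where "t = real (num_distances P)"
  define b where "b = 2 * k * m"
  define v where "v \<delta> = card (points_at_distance P \<delta>)" for \<delta>
  \<comment> \<open>Truncation keeps \<open>y\<close> nonnegative, as the power mean inequality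
    requires, while \<open>v \<delta> \<le> y \<delta> + b\<close> still holds.\<close>
  define y where "y \<delta> = real (v \<delta> - b)" for \<delta>
  define c where "c = min (1 / (8 * real k ^ 2 * real m))
      ((1 / ((4 * real k) ^ m * real (j * m ^ 2))) powr (1 / real d))"
  have k: "2 \<le> k" using assms(5,6) unfolding k_def by (cases j; cases d) auto
  have n: "2 \<le> n" using assms(3) by (simp add: n_def)
  have c1: "c \<le> 1 / (8 * real k ^ 2 * real m)"
    and c2: "c \<le> (1 / ((4 * real k) ^ m * real (j * m ^ 2))) powr (1 / real d)"
    by (simp_all add: c_def)
  have "real (card P * (card P - 1)) \<le> real (k * (\<Sum>\<delta>\<in>distances P. v \<delta>))"
    using sum_points_at_distance_ge[OF assms(2,4,7) k] unfolding v_def of_nat_le_iff .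
  then have "n * (n - 1) \<le> k * (\<Sum>\<delta>\<in>distances P. real (v \<delta>))"
    using assms(3) by (simp add: n_def of_nat_diff)
  moreover have "n ^ 2 / 2 \<le> n * (n - 1)"
    using mult_right_mono[of 2 n n] n by (simp add: power2_eq_square right_diff_distrib)
  ultimately have "n ^ 2 / 2 \<le> k * (\<Sum>\<delta>\<in>distances P. real (v \<delta>))" by linarith
  also have "\<dots> \<le> k * (\<Sum>\<delta>\<in>distances P. y \<delta> + b)"
    by (intro mult_left_mono sum_mono) (auto simp: y_def)
  also have "\<dots> = k * ((\<Sum>\<delta>\<in>distances P. y \<delta>) + t * b)"
    by (simp add: sum.distrib t_def num_distances_def)
  finally have W: "n ^ 2 / (2 * k) \<le> (\<Sum>\<delta>\<in>distances P. y \<delta>) + t * b"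
    using k by (simp add: field_simps)
  have "c * n powr (1 + 1 / real d) \<le> t"
  \<comment> \<open>By \<open>W\<close>, either the loss \<open>t * b\<close> or the sum of the
    \<open>y \<delta>\<close> reaches half of \<open>n ^ 2 / (2 * k)\<close>.\<close>
  proof (cases "n ^ 2 / (4 * k) \<le> t * b")
    case True
    have "n powr (1 + 1 / real d) \<le> n powr 2"
      using n assms(6) by (intro powr_mono) auto
    then have "c * n powr (1 + 1 / real d) \<le> 1 / (8 * real k ^ 2 * real m) * n ^ 2"
      using n by (intro mult_mono c1) (auto simp: powr_numeral)
    also have "\<dots> \<le> t"
    proof -
      have "0 < 8 * real k ^ 2 * real m" using k by (simp add: m_def)
      moreover have "n ^ 2 \<le> t * (8 * real k ^ 2 * real m)"
        using True k by (simp add: b_def field_simps power2_eq_square)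
      ultimately have "n ^ 2 / (8 * real k ^ 2 * real m) \<le> t" by (simp only: pos_divide_le_eq)
      then show ?thesis by simp
    qed
    finally show ?thesis .
  next
    case False
    have "n ^ 2 / (2 * k) = n ^ 2 / (4 * k) + n ^ 2 / (4 * k)" by simp
    with False W have "n ^ 2 / (4 * k) \<le> (\<Sum>\<delta>\<in>distances P. y \<delta>)" by linarith
    then have "(n ^ 2 / (4 * k)) ^ m \<le> (\<Sum>\<delta>\<in>distances P. y \<delta>) ^ m"
      by (rule power_mono) simp
    also have "\<dots> \<le> t ^ d * (\<Sum>\<delta>\<in>distances P. y \<delta> ^ m)"
      unfolding m_def t_def num_distances_def
      by (rule sum_power_le_card_power) (simp add: y_def)
    also have "(\<Sum>\<delta>\<in>distances P. y \<delta> ^ m) = real (\<Sum>\<delta>\<in>distances P. (v \<delta> - b) ^ m)"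
      by (simp add: y_def)
    also have "t ^ d * real (\<Sum>\<delta>\<in>distances P. (v \<delta> - b) ^ m) \<le> t ^ d * real (j * m ^ 2 * card P ^ m)"
      using sum_power_points_at_distance_le[of P j "Suc d" l] assms k
      by (intro mult_left_mono of_nat_mono) (auto simp: v_def b_def m_def k_def t_def)
    \<comment> \<open>Of the \<open>2 * m\<close> factors \<open>n\<close> on the left,
      \<open>m\<close> cancel against the number of lists. The remaining \<open>n ^ m\<close> gives
      the exponent \<open>m / d = 1 + 1 / d\<close> after taking the \<open>d\<close>-th
      root.\<close>
    finally have "n ^ m * (n / (4 * k)) ^ m \<le> n ^ m * (t ^ d * real (j * m ^ 2))"
      by (simp add: n_def power2_eq_square power_mult_distrib power_divide mult_ac)
    then have "(n / (4 * k)) ^ m \<le> t ^ d * real (j * m ^ 2)"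
      using n by simp
    moreover have jm: "0 < real (j * m ^ 2)" using assms(5) by (simp add: m_def)
    ultimately have "(n / (4 * k)) ^ m / real (j * m ^ 2) \<le> t ^ d"
      by (simp only: pos_divide_le_eq)
    then have A: "1 / ((4 * real k) ^ m * real (j * m ^ 2)) * n ^ m \<le> t ^ d"
      by (simp add: power_divide)
    have "1 + 1 / real d = real m * (1 / real d)"
      using assms(6) by (simp add: m_def field_simps)
    then have "n powr (1 + 1 / real d) = (n powr real m) powr (1 / real d)"
      by (simp only: powr_powr)
    then have "c * n powr (1 + 1 / real d) = c * (n ^ m) powr (1 / real d)"
      using n by (simp add: powr_realpow)
    also have "\<dots> \<le> (1 / ((4 * real k) ^ m * real (j * m ^ 2))) powr (1 / real d) * (n ^ m) powr (1 / real d)"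
      by (intro mult_right_mono c2) simp
    also have "\<dots> = (1 / ((4 * real k) ^ m * real (j * m ^ 2)) * n ^ m) powr (1 / real d)"
      by (rule powr_mult[symmetric])
    also have "\<dots> \<le> (t ^ d) powr (1 / real d)"
      using A n by (intro powr_mono2) auto
    also have "\<dots> = t"
    \<comment> \<open>Rewriting the power as \<open>powr\<close> needs a positive base; for
      \<open>t = 0\<close> both sides are 0.\<close>
    proof (cases "t = 0")
      case True
      then show ?thesis using assms(6) by simp
    next
      case False
      then have "0 < t" by (simp add: t_def)
      then show ?thesis using assms(6) by (simp add: powr_powr flip: powr_realpow)
    qed
    finally show ?thesis .
  qed
  then show ?thesis by (simp only: c_def m_def n_def t_def)
qed

section \<open>Sets without repeated distances, and attainment of the minimum\<close>

lemma power_2_diff_eqD: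
  fixes a b a' b' :: nat
  assumes "b < a" "b' < a'" "(2::int) ^ a - 2 ^ b = 2 ^ a' - 2 ^ b'"
  shows "a = a' \<and> b = b'"
proof -
  \<comment> \<open>The difference lies in the dyadic range from \<open>2 ^ (a - 1)\<close> up to
    but excluding \<open>2 ^ a\<close>, so it determines \<open>a\<close>, and then
    \<open>b\<close>.\<close>
  have bound: "(2::int) ^ (a - 1) \<le> 2 ^ a - 2 ^ b" "(2::int) ^ a - 2 ^ b < 2 ^ a"
    if ba: "b < a" for a b :: nat
  proof -
    obtain e where e: "a = Suc e" using ba by (cases a) auto
    then have "(2::int) ^ b \<le> 2 ^ e" using ba by (intro power_increasing) auto
    then show "(2::int) ^ (a - 1) \<le> 2 ^ a - 2 ^ b" using e by simp
  qed simp
  have "(2::int) ^ (a - 1) < 2 ^ a'" "(2::int) ^ (a' - 1) < 2 ^ a"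
    using bound[OF assms(1)] bound[OF assms(2)] assms(3) by linarith+
  then have "a - 1 < a'" "a' - 1 < a" by simp_all
  then have "a = a'" using assms(1,2) by linarith
  then show ?thesis using assms(3) by simp
qed

text \<open>The points lie on a line at the positions \<open>2 ^ i\<close>. Their distances are
  differences of powers of two, which determine the pair.\<close>

lemma exists_all_distances_distinct:
  "\<exists>P::(real^2) set. finite P \<and> card P = n \<and> local_property k (k choose 2) P"
proof -
  have norm_axis_real: "norm (axis 1 x :: real^2) = \<bar>x\<bar>" for x
    by (simp add: norm_eq_sqrt_inner inner_axis_axis)
  define f :: "nat \<Rightarrow> real^2" where "f i = axis 1 (2 ^ i)" for i
  have dist: "dist (f a) (f b) = real_of_int (2 ^ a - 2 ^ b)" if "b \<le> a" for a b
  proof -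
    have "f a - f b = axis 1 (2 ^ a - 2 ^ b)"
      by (simp add: f_def vec_eq_iff axis_def)
    moreover have "(2::real) ^ b \<le> 2 ^ a" using that by (intro power_increasing) auto
    ultimately show ?thesis by (simp add: dist_norm norm_axis_real)
  qed
  have "inj f" by (auto simp: inj_def f_def axis_eq_axis)
  have "local_property k (k choose 2) (f ` {..<n})"
    unfolding local_property_def
  proof (intro allI impI)
    fix Q assume Q: "Q \<subseteq> f ` {..<n} \<and> card Q = k"
    have form: "\<exists>a b. b < a \<and> e = {f a, f b} \<and> diameter e = real_of_int (2 ^ a - 2 ^ b)"
      if e: "e \<subseteq> Q" "card e = 2" for e
    proof -
      obtain p q where pq: "e = {p, q}" "p \<noteq> q" using e(2) by (auto simp: card_2_iff)
      then obtain a b where ab: "p = f a" "q = f b" using e(1) Q by blast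
      then have "a \<noteq> b" using pq by auto
      then have "a < b \<or> b < a" by (rule nat_neq_iff[THEN iffD1])
      then show ?thesis
      proof
        assume "a < b"
        moreover have e': "e = {f b, f a}" unfolding pq(1) ab by (rule insert_commute)
        moreover have "diameter e = real_of_int (2 ^ b - 2 ^ a)"
          unfolding e' diameter_pair using \<open>a < b\<close> by (intro dist less_imp_le)
        ultimately show ?thesis by (intro exI conjI)
      next
        assume "b < a"
        moreover have e': "e = {f a, f b}" unfolding pq(1) ab ..
        moreover have "diameter e = real_of_int (2 ^ a - 2 ^ b)"
          unfolding e' diameter_pair using \<open>b < a\<close> by (intro dist less_imp_le)
        ultimately show ?thesis by (intro exI conjI)
      qed
    qed
    have "inj_on diameter {e. e \<subseteq> Q \<and> card e = 2}"
    proof (rule inj_onI, clarify)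
      fix e e' assume e: "e \<subseteq> Q" "card e = 2" "e' \<subseteq> Q" "card e' = 2" "diameter e = diameter e'"
      obtain a b where ab: "b < a" "e = {f a, f b}" "diameter e = real_of_int (2 ^ a - 2 ^ b)"
        using form e by blast
      obtain a' b' where ab': "b' < a'" "e' = {f a', f b'}" "diameter e' = real_of_int (2 ^ a' - 2 ^ b')"
        using form e by blast
      have "(2::int) ^ a - 2 ^ b = 2 ^ a' - 2 ^ b'"
        using ab ab' e(5) by (simp only: of_int_eq_iff)
      then show "e = e'" using power_2_diff_eqD[of b a b' a'] ab ab' by simp
    qed
    then have "num_distances Q = card {e. e \<subseteq> Q \<and> card e = 2}"
      unfolding num_distances_def distances_eq_diameter_image by (rule card_image)
    also have "\<dots> = k choose 2"
      using Q finite_subset[of Q "f ` {..<n}"] n_subsets[of Q 2] by simp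
    finally show "k choose 2 \<le> num_distances Q" by simp
  qed
  moreover have "card (f ` {..<n}) = n"
    using \<open>inj f\<close> by (simp add: card_image inj_on_subset)
  ultimately show ?thesis by (intro exI[of _ "f ` {..<n}"]) auto
qed

text \<open>The bound on \<open>l\<close> makes the set under \<open>Inf\<close> nonempty, and a
  nonempty set of naturals contains its infimum. Thus a lower bound for every admissible set carries
  over to \<open>phi\<close>.\<close>

lemma phi_attained:
  assumes "l \<le> k choose 2"
  obtains P where "finite P" "card P = n" "local_property k l P" "phi n k l = num_distances P"
proof -
  obtain P :: "(real^2) set" where P: "finite P" "card P = n" "local_property k (k choose 2) P"
    using exists_all_distances_distinct by blast
  then have "local_property k l P"
    using assms by (auto simp: local_property_def intro: order_trans)
  then have "{num_distances P | P. finite P \<and> card P = n \<and> local_property k l P} \<noteq> {}"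
    using P by blast
  from Inf_nat_def1[OF this] show ?thesis
    using that unfolding phi_def by blast
qed

section \<open>The numerical conditions on \<open>k\<close> and \<open>l\<close>, and the passage to
  asymptotics\<close>

theorem theorem1p1:
  fixes c d :: nat
  assumes "c \<ge> 2" and "d \<ge> 2"
  shows "(\<lambda>n. real (phi n (c * (d + 1)) ((c * (d + 1) choose 2) - d * c + (d + 1))))
           \<in> \<Omega>(\<lambda>n. real n powr (1 + 1 / real d))"
proof -
  \<comment> \<open>\<open>j = c - 1\<close> is the number of colours whose edges meet at a common
    tuple in the forbidden configuration.\<close>
  obtain j where j: "c = j + 1" "1 \<le> j" using assms(1) by (cases c) auto
  define k where "k = (j + 1) * Suc d"
  define l where "l = (k choose 2) - d * c + (d + 1)"
  have dc: "d + 1 \<le> d * c" using mult_le_mono2[OF assms(1), of d] assms(2) by linarith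
  have kc: "k = c * (d + 1)" by (simp add: k_def j)
  \<comment> \<open>This leads to \<open>d * c \<le> k choose 2\<close>, so the natural subtraction
    in \<open>l\<close> is exact.\<close>
  have "c * 2 \<le> k" unfolding kc using assms by (intro mult_le_mono) auto
  then have "2 \<le> k - 1" using assms by linarith
  then have "k * 2 \<le> k * (k - 1)" by (rule mult_le_mono2)
  then have "d * c \<le> k choose 2" unfolding choose_two by (simp add: kc algebra_simps)
  then have l: "l + d * c = (k choose 2) + (d + 1)" by (simp add: l_def)
  have dcj: "d * c = d * j + d" by (simp add: j)
  have lk: "l \<le> k choose 2" using l dc by linarith
  have k: "k = j * d + j + d + 1" by (simp add: k_def algebra_simps)
  have h1: "(k choose 2) + 2 < l + k" using l dcj k j assms(2) by (simp add: mult.commute)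
  \<comment> \<open>Here \<open>l = (k choose 2) - d * j + 1\<close>, so the two sides differ by
    exactly 1: \<open>l\<close> is the least value that forbids \<open>j * (d + 1)\<close> edges in
    \<open>j\<close> colours on \<open>k\<close> points.\<close>
  have h2: "(k choose 2) + j < l + j * Suc d" using l dcj by (simp add: mult.commute)
  define C where "C = min (1 / (8 * real k ^ 2 * real (Suc d)))
      ((1 / ((4 * real k) ^ Suc d * real (j * (Suc d) ^ 2))) powr (1 / real d))"
  have "0 < k" by (simp add: k_def)
  then have "0 < C" using j(2) unfolding C_def by simp
  moreover have "C * real n powr (1 + 1 / real d) \<le> real (phi n k l)" if "2 \<le> n" for n
  proof -
    obtain P where P: "finite P" "card P = n" "local_property k l P" "phi n k l = num_distances P"
      using phi_attained[OF lk] by blast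
    then show ?thesis
      using num_distances_ge[of P j d l] that j(2) assms(2) h1 h2 by (simp add: k_def C_def)
  qed
  ultimately have "(\<lambda>n. real (phi n k l)) \<in> \<Omega>(\<lambda>n. real n powr (1 + 1 / real d))"
    by (intro landau_omega.bigI[of C] eventually_sequentiallyI[of 2]) auto
  then show ?thesis by (simp only: l_def kc)
qed

end
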